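(* Let $\mathcal{A}$ be a unital prime $\ast$-algebra over $\mathbb{C}$ with identity $I$. For $A,B\in\mathcal{A}$ put $A\diamond B = A^{*}B - B^{*}A$. Let $\Phi:\mathcal{A}\to\mathcal{A}$ be a map (not assumed to be linear or additive) satisfying $$\Phi(A\diamond B)=\Phi(A)\diamond B+A\diamond\Phi(B)\qquad\text{for all } A,B\in\mathcal{A}.$$ If $\Phi\left(\alpha\frac{I}{2}\right)$ is self-adjoint for each $\alpha\in\{1,i\}$, then $\Phi$ is an additive $\ast$-derivation; that is, for all $A,B\in\mathcal{A}$, $\Phi(A+B)=\Phi(A)+\Phi(B)$, $\Phi(AB)=\Phi(A)B+A\Phi(B)$ and $\Phi(A^{*})=\Phi(A)^{*}$.
   Context: A $\ast$-algebra over $\mathbb{C}$ is an associative complex algebra with a conjugate-linear involution $A\mapsto A^{*}$ satisfying $(AB)^{*}=B^{*}A^{*}$ and $(A^{*})^{*}=A$. It is prime if, for $A,B\in\mathcal{A}$, $A\mathcal{A}B=\{0\}$ implies $A=0$ or $B=0$. An element $A$ is self-adjoint if $A^{*}=A$. An additive derivation is a map $\Phi:\mathcal{A}\to\mathcal{A}$ with $\Phi(A+B)=\Phi(A)+\Phi(B)$ and $\Phi(AB)=\Phi(A)B+A\Phi(B)$ for all $A,B\in\mathcal{A}$; it is an additive $\ast$-derivation if moreover $\Phi(A^{*})=\Phi(A)^{*}$ for all $A\in\mathcal{A}$. *)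

theory Defs
  imports Complex_Main
begin

text \<open>
  The ring structure of the algebra is carried by the type; the complex scalar multiplication
  and the involution are locale parameters. No unit is assumed here: unital algebras are obtained
  from the sort \<open>{ring, monoid_mult}\<close>, which, unlike \<open>ring_1\<close>, does not
  impose \<open>0 \<noteq> 1\<close>.
\<close>

locale complex_algebra = vector_space scale
  for scale :: "complex \<Rightarrow> 'a::ring \<Rightarrow> 'a" +
  assumes scale_mult_left: "scale c a * b = scale c (a * b)"
    and scale_mult_right: "a * scale c b = scale c (a * b)"

locale star_algebra = complex_algebra scale
  for scale :: "complex \<Rightarrow> 'a::ring \<Rightarrow> 'a" +
  fixes star :: "'a \<Rightarrow> 'a"
  assumes star_add: "star (a + b) = star a + star b"
    and star_scale: "star (scale c a) = scale (cnj c) (star a)"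
    and star_mult: "star (a * b) = star b * star a"
    and star_star: "star (star a) = a"

locale prime_star_algebra = star_algebra scale star
  for scale :: "complex \<Rightarrow> 'a::ring \<Rightarrow> 'a" and star :: "'a \<Rightarrow> 'a" +
  assumes prime: "{a * x * b |x. x \<in> UNIV} = {0 :: 'a} \<Longrightarrow> a = 0 \<or> b = 0"

definition self_adjoint :: "('a \<Rightarrow> 'a) \<Rightarrow> 'a \<Rightarrow> bool" where
  "self_adjoint star a \<longleftrightarrow> star a = a"

definition diamond :: "('a::ring \<Rightarrow> 'a) \<Rightarrow> 'a \<Rightarrow> 'a \<Rightarrow> 'a" where
  "diamond star a b = star a * b - star b * a"

definition additive_derivation :: "('a::ring \<Rightarrow> 'a) \<Rightarrow> bool" where
  "additive_derivation \<Phi> \<longleftrightarrow>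
     (\<forall>a b. \<Phi> (a + b) = \<Phi> a + \<Phi> b) \<and>
     (\<forall>a b. \<Phi> (a * b) = \<Phi> a * b + a * \<Phi> b)"

definition additive_star_derivation :: "('a::ring \<Rightarrow> 'a) \<Rightarrow> ('a \<Rightarrow> 'a) \<Rightarrow> bool" where
  "additive_star_derivation star \<Phi> \<longleftrightarrow>
     additive_derivation \<Phi> \<and> (\<forall>a. \<Phi> (star a) = star (\<Phi> a))"

end

theory Submission
  imports Defs
begin

text \<open>
  Write \<open>A \<diamond> B\<close> for the product of the statement. Every \<open>A \<diamond> B\<close> is skew-adjoint, and
  multiplication by scalars in this product isolates the two halves of an element: \<open>(I/2) \<diamond> B\<close>
  is the skew-adjoint part of \<open>B\<close>, while \<open>(iI/2) \<diamond> B\<close> is \<open>- i\<close> times its self-adjoint part.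

  A skew-adjoint \<open>K\<close> equals \<open>(I/2) \<diamond> K\<close>, so \<open>\<Phi>\<close> preserves skew-adjointness. Hence \<open>\<Phi>(iI/2)\<close>
  is both self-adjoint and skew-adjoint, so it vanishes; evaluating at \<open>K = iI/2\<close> then
  gives \<open>\<Phi>(I/2) = 0\<close>. It follows that \<open>\<Phi>\<close> commutes with \<open>B \<mapsto> (I/2) \<diamond> B\<close> and
  with \<open>B \<mapsto> (iI/2) \<diamond> B\<close>, so that \<open>\<Phi>\<close> is determined by its values on skew-adjoint elements
  (\<open>\<Phi>_skew_part\<close>, \<open>\<Phi>_minus_i_herm_part\<close>).

  Additivity comes from the scalar \<open>(1+i)/2\<close>, which \<open>\<Phi>\<close> also annihilates. Applying \<open>\<Phi>\<close> to
  \<open>((1+i)I/2) \<diamond> B = (I/2) \<diamond> B + (iI/2) \<diamond> B\<close> gives additivity on a sum of two skew-adjoint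
  elements, and these are arbitrary because the two halves of \<open>B\<close> can be prescribed independently
  (\<open>\<Phi>_add_skew\<close>). Additivity everywhere, \<open>\<Phi>(iB) = i \<Phi>(B)\<close> and \<open>\<Phi>(B\<^sup>*) = \<Phi>(B)\<^sup>*\<close> follow by treating
  the halves separately. Finally, the ordinary product is recovered from the polarization identity
  \<open>2 A\<^sup>*B = (A \<diamond> B) - i (A \<diamond> iB)\<close>, which turns the \<open>\<diamond>\<close>-Leibniz rule into the usual one.
\<close>

section \<open>Self-adjoint and skew-adjoint parts in a unital star-algebra\<close>

locale unital_star_algebra = star_algebra scale star
  for scale :: "complex \<Rightarrow> 'a::{ring,monoid_mult} \<Rightarrow> 'a" and star :: "'a \<Rightarrow> 'a"
begin

definition herm_part :: "'a \<Rightarrow> 'a" where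
  "herm_part a = scale (1/2) (a + star a)"

definition skew_part :: "'a \<Rightarrow> 'a" where
  "skew_part a = scale (1/2) (a - star a)"

lemma star_zero: "star 0 = 0"
  using star_add[of 0 0] by simp

lemma star_minus: "star (- a) = - star a"
  using star_add[of a "- a"] star_zero by (simp add: eq_neg_iff_add_eq_0 add.commute)

lemma star_diff: "star (a - b) = star a - star b"
  using star_add[of a "- b"] star_minus by simp

lemma star_one: "star 1 = 1"
  using star_mult[of "star 1" 1] by (simp only: star_star mult_1_right)

lemmas star_simps =
  star_zero star_minus star_diff star_one star_add star_scale star_mult star_star

lemma scale_half_double: "scale (1/2) (a + a) = a"
  by (simp add: scale_right_distrib flip: scale_left_distrib)

lemma eq_minus_self_imp_zero: "(a :: 'a) = - a \<Longrightarrow> a = 0"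
  using scale_half_double[of a] by (metis add.right_inverse scale_zero_right)

lemma double_eq_imp_eq: "(a :: 'a) + a = b + b \<Longrightarrow> a = b"
  by (metis scale_half_double)

lemma herm_part_plus_skew_part: "herm_part a + skew_part a = a"
  by (simp add: herm_part_def skew_part_def scale_half_double flip: scale_right_distrib)

lemma herm_part_add: "herm_part (a + b) = herm_part a + herm_part b"
  by (simp add: herm_part_def star_add algebra_simps flip: scale_right_distrib)

lemma skew_part_add: "skew_part (a + b) = skew_part a + skew_part b"
  by (simp add: skew_part_def star_add algebra_simps flip: scale_right_distrib)

lemma star_herm_part: "star (herm_part a) = herm_part a"
  by (simp add: herm_part_def star_simps add.commute)

lemma star_skew_part: "star (skew_part a) = - skew_part a"
  by (simp add: skew_part_def star_simps flip: scale_minus_right)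

lemma herm_part_eq_self: "star a = a \<Longrightarrow> herm_part a = a"
  by (simp add: herm_part_def scale_half_double)

lemma skew_part_eq_self: "star a = - a \<Longrightarrow> skew_part a = a"
  by (simp add: skew_part_def scale_half_double)

lemma herm_part_of_skew: "star a = - a \<Longrightarrow> herm_part a = 0"
  by (simp add: herm_part_def)

lemma skew_part_of_herm: "star a = a \<Longrightarrow> skew_part a = 0"
  by (simp add: skew_part_def)

lemma scale_i_i: "scale \<i> (scale \<i> a) = - a"
  by (simp add: scale_minus_left)

lemma star_scale_i: "star (scale \<i> a) = - scale \<i> (star a)"
  by (simp add: star_scale)

lemma diamond_half_one: "diamond star (scale (1/2) 1) b = skew_part b"
  by (simp add: diamond_def skew_part_def star_simps scale_mult_left scale_mult_right
      scale_right_diff_distrib)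

lemma diamond_half_i: "diamond star (scale (\<i>/2) 1) b = - scale \<i> (herm_part b)"
  by (simp add: diamond_def herm_part_def star_simps scale_mult_left scale_mult_right
      scale_right_distrib)

lemma diamond_add_left: "diamond star (a + b) c = diamond star a c + diamond star b c"
  by (simp add: diamond_def star_add algebra_simps)

lemma star_diamond: "star (diamond star a b) = - diamond star a b"
  by (simp add: diamond_def star_simps)

lemma double_star_mult:
  "star a * b + star a * b = diamond star a b - scale \<i> (diamond star a (scale \<i> b))"
proof -
  have "diamond star a (scale \<i> b) = scale \<i> (star a * b + star b * a)"
    by (simp add: diamond_def star_scale_i scale_mult_left scale_mult_right scale_right_distrib)
  then have "scale \<i> (diamond star a (scale \<i> b)) = - (star a * b + star b * a)"
    by (simp only: scale_i_i)
  then show ?thesis by (simp add: diamond_def)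
qed

end

section \<open>Maps satisfying the Leibniz rule for the skew product\<close>

locale diamond_derivation = unital_star_algebra scale star
  for scale :: "complex \<Rightarrow> 'a::{ring,monoid_mult} \<Rightarrow> 'a" and star :: "'a \<Rightarrow> 'a" +
  fixes \<Phi> :: "'a \<Rightarrow> 'a"
  assumes \<Phi>_diamond: "\<Phi> (diamond star a b) = diamond star (\<Phi> a) b + diamond star a (\<Phi> b)"
    and \<Phi>_half_one_herm: "star (\<Phi> (scale (1/2) 1)) = \<Phi> (scale (1/2) 1)"
    and \<Phi>_half_i_herm: "star (\<Phi> (scale (\<i>/2) 1)) = \<Phi> (scale (\<i>/2) 1)"
begin

lemma \<Phi>_zero: "\<Phi> 0 = 0"
  using \<Phi>_diamond[of 0 0] by (simp add: diamond_def star_zero)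

text \<open>
  A skew-adjoint element is itself a value of the product, namely \<open>(I/2) \<diamond> a\<close>, and the Leibniz
  rule expresses the image of such a value by further values of the product, which are skew-adjoint.
\<close>
lemma star_\<Phi>_skew:
  assumes "star a = - a"
  shows "star (\<Phi> a) = - \<Phi> a"
proof -
  have "diamond star (scale (1/2) 1) a = a"
    using assms by (simp only: diamond_half_one skew_part_eq_self)
  moreover have "star (\<Phi> (diamond star b c)) = - \<Phi> (diamond star b c)" for b c
    by (simp only: \<Phi>_diamond star_add star_diamond minus_add_distrib)
  ultimately show ?thesis by metis
qed

lemma star_half_i: "star (scale (\<i>/2) 1) = - scale (\<i>/2) 1"
  by (simp add: star_simps)

lemma \<Phi>_half_i: "\<Phi> (scale (\<i>/2) 1) = 0"
  using star_\<Phi>_skew[OF star_half_i] \<Phi>_half_i_herm eq_minus_self_imp_zero by metis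

text \<open>
  For skew-adjoint \<open>K\<close>, both \<open>K\<close> and \<open>\<Phi> K\<close> are fixed by \<open>(I/2) \<diamond> _\<close>, so the Leibniz rule leaves
  \<open>\<Phi>(I/2) \<diamond> K = 0\<close>. The choice \<open>K = iI/2\<close> turns this into \<open>i \<Phi>(I/2) = 0\<close>.
\<close>
lemma \<Phi>_half_one: "\<Phi> (scale (1/2) 1) = 0"
proof -
  let ?k = "scale (\<i>/2) 1" and ?c = "\<Phi> (scale (1/2) 1)"
  have "\<Phi> ?k = diamond star ?c ?k + \<Phi> ?k"
    using \<Phi>_diamond[of "scale (1/2) 1" ?k] star_half_i star_\<Phi>_skew[OF star_half_i]
    by (simp only: diamond_half_one skew_part_eq_self)
  then have "diamond star ?c ?k = 0" by simp
  then have "scale (\<i>/2) ?c + scale (\<i>/2) ?c = 0"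
    by (simp add: diamond_def \<Phi>_half_one_herm star_half_i scale_mult_left scale_mult_right)
  then show ?thesis by (simp flip: scale_left_distrib)
qed

lemma \<Phi>_skew_part: "\<Phi> (skew_part b) = skew_part (\<Phi> b)"
  using \<Phi>_diamond[of "scale (1/2) 1" b]
  by (simp only: diamond_half_one \<Phi>_half_one) (simp add: diamond_def star_zero)

lemma \<Phi>_minus_i_herm_part: "\<Phi> (- scale \<i> (herm_part b)) = - scale \<i> (herm_part (\<Phi> b))"
  using \<Phi>_diamond[of "scale (\<i>/2) 1" b]
  by (simp only: diamond_half_i \<Phi>_half_i) (simp add: diamond_def star_zero)

lemma \<Phi>_half_one_plus_half_i: "\<Phi> (scale (1/2) 1 + scale (\<i>/2) 1) = 0"
proof -
  let ?h = "scale (1/2) 1" and ?k = "scale (\<i>/2) 1"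
  have h: "star ?h = ?h" by (simp add: star_simps)
  have "skew_part (?h + ?k) = ?k" "herm_part (?h + ?k) = ?h"
    using h star_half_i
    by (simp_all only: skew_part_add herm_part_add skew_part_eq_self herm_part_eq_self
        skew_part_of_herm herm_part_of_skew add_0_left add_0_right)
  then have skew: "skew_part (\<Phi> (?h + ?k)) = 0"
    and i_herm: "- scale \<i> (herm_part (\<Phi> (?h + ?k))) = \<Phi> (- scale \<i> ?h)"
    using \<Phi>_skew_part[of "?h + ?k"] \<Phi>_minus_i_herm_part[of "?h + ?k"] \<Phi>_half_i by simp_all
  have "\<Phi> (- scale \<i> ?h) = 0"
    using \<Phi>_minus_i_herm_part[of ?h]
    by (simp only: herm_part_eq_self[OF h] \<Phi>_half_one herm_part_eq_self[OF star_zero]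
        scale_zero_right minus_zero)
  then have "herm_part (\<Phi> (?h + ?k)) = 0"
    using i_herm by simp
  then show ?thesis
    using skew herm_part_plus_skew_part[of "\<Phi> (?h + ?k)"] by simp
qed

section \<open>Additivity and compatibility with \<open>\<i>\<close> and the star\<close>

text \<open>
  The map \<open>b \<mapsto> ((1+i)I/2) \<diamond> b\<close>, which commutes with \<open>\<Phi>\<close> because \<open>\<Phi>((1+i)I/2) = 0\<close>, sends \<open>b\<close> to
  the sum of its skew-adjoint part and of \<open>- i\<close> times its self-adjoint part; the element
  \<open>b = k + i l\<close> realizes the sum \<open>k + l\<close>.
\<close>
lemma \<Phi>_add_skew:
  assumes k: "star k = - k" and l: "star l = - l"
  shows "\<Phi> (k + l) = \<Phi> k + \<Phi> l"
proof -
  let ?e = "scale (1/2) 1 + scale (\<i>/2) 1" and ?b = "k + scale \<i> l"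
  have il: "star (scale \<i> l) = scale \<i> l"
    using l by (simp add: star_scale_i)
  have parts: "skew_part ?b = k" "- scale \<i> (herm_part ?b) = l"
    using k il by (simp_all only: skew_part_add herm_part_add skew_part_eq_self herm_part_eq_self
        skew_part_of_herm herm_part_of_skew add_0_left add_0_right scale_i_i minus_minus)
  have e: "diamond star ?e x = skew_part x - scale \<i> (herm_part x)" for x
    by (simp only: diamond_add_left diamond_half_one diamond_half_i) simp
  have "\<Phi> (k + l) = \<Phi> (diamond star ?e ?b)"
    using parts by (simp only: e) (simp add: diff_conv_add_uminus del: add_uminus_conv_diff)
  also have "\<dots> = diamond star ?e (\<Phi> ?b)"
    by (simp only: \<Phi>_diamond \<Phi>_half_one_plus_half_i) (simp add: diamond_def star_zero)
  also have "\<dots> = \<Phi> (skew_part ?b) + \<Phi> (- scale \<i> (herm_part ?b))"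
    by (simp only: e \<Phi>_skew_part \<Phi>_minus_i_herm_part) simp
  finally show ?thesis by (simp only: parts)
qed

lemma star_minus_i_herm_part: "star (- scale \<i> (herm_part a)) = - (- scale \<i> (herm_part a))"
  by (simp add: star_minus star_scale_i star_herm_part)

lemma \<Phi>_add: "\<Phi> (a + b) = \<Phi> a + \<Phi> b"
proof -
  have "skew_part (\<Phi> (a + b)) = skew_part (\<Phi> a) + skew_part (\<Phi> b)"
    using \<Phi>_add_skew[OF star_skew_part star_skew_part, of a b]
    by (simp only: \<Phi>_skew_part flip: skew_part_add)
  moreover have "herm_part (\<Phi> (a + b)) = herm_part (\<Phi> a) + herm_part (\<Phi> b)"
  proof -
    have "- scale \<i> (herm_part (\<Phi> (a + b))) = \<Phi> (- scale \<i> (herm_part a) + - scale \<i> (herm_part b))"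
      by (simp add: herm_part_add scale_right_distrib flip: \<Phi>_minus_i_herm_part)
    also have "\<dots> = - scale \<i> (herm_part (\<Phi> a) + herm_part (\<Phi> b))"
      by (simp only: \<Phi>_add_skew[OF star_minus_i_herm_part star_minus_i_herm_part]
          \<Phi>_minus_i_herm_part scale_right_distrib minus_add_distrib)
    finally show ?thesis by (simp del: scale_minus_right)
  qed
  ultimately show ?thesis
    by (metis herm_part_plus_skew_part herm_part_add skew_part_add)
qed

lemma \<Phi>_minus: "\<Phi> (- a) = - \<Phi> a"
  using \<Phi>_add[of a "- a"] \<Phi>_zero by (simp add: eq_neg_iff_add_eq_0 add.commute)

lemma \<Phi>_diff: "\<Phi> (a - b) = \<Phi> a - \<Phi> b"
  using \<Phi>_add[of a "- b"] by (simp add: \<Phi>_minus)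

lemma star_\<Phi>_herm:
  assumes "star a = a"
  shows "star (\<Phi> a) = \<Phi> a"
proof -
  have "skew_part (\<Phi> a) = 0"
    using \<Phi>_skew_part[of a] assms by (simp add: skew_part_of_herm \<Phi>_zero)
  then show ?thesis
    using herm_part_plus_skew_part[of "\<Phi> a"] star_herm_part[of "\<Phi> a"] by simp
qed

lemma \<Phi>_scale_i_herm:
  assumes "star a = a"
  shows "\<Phi> (scale \<i> a) = scale \<i> (\<Phi> a)"
  using \<Phi>_minus_i_herm_part[of a] assms star_\<Phi>_herm[OF assms]
  by (simp add: herm_part_eq_self \<Phi>_minus)

lemma \<Phi>_scale_i: "\<Phi> (scale \<i> a) = scale \<i> (\<Phi> a)"
proof -
  have skew: "\<Phi> (scale \<i> k) = scale \<i> (\<Phi> k)" if "star k = - k" for k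
  proof -
    \<comment> \<open>Here \<open>i k\<close> is self-adjoint, and multiplying by \<open>i\<close> once more returns \<open>- k\<close>.\<close>
    have "\<Phi> (scale \<i> (scale \<i> k)) = scale \<i> (\<Phi> (scale \<i> k))"
      using that by (intro \<Phi>_scale_i_herm) (simp add: star_scale_i)
    then have "\<Phi> k = - scale \<i> (\<Phi> (scale \<i> k))"
      by (simp only: scale_i_i \<Phi>_minus) (metis minus_minus)
    then have "scale \<i> (\<Phi> k) = - scale \<i> (scale \<i> (\<Phi> (scale \<i> k)))"
      by (simp only: scale_minus_right)
    then show ?thesis by (simp only: scale_i_i minus_minus)
  qed
  have "\<Phi> (scale \<i> (herm_part a + skew_part a)) = scale \<i> (\<Phi> (herm_part a + skew_part a))"
    by (simp only: scale_right_distrib \<Phi>_add \<Phi>_scale_i_herm[OF star_herm_part]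
        skew[OF star_skew_part])
  then show ?thesis by (simp only: herm_part_plus_skew_part)
qed

lemma \<Phi>_star: "\<Phi> (star a) = star (\<Phi> a)"
proof -
  have "\<Phi> (star (herm_part a + skew_part a)) = star (\<Phi> (herm_part a + skew_part a))"
    by (simp only: star_add \<Phi>_add \<Phi>_minus star_herm_part star_skew_part
        star_\<Phi>_herm[OF star_herm_part] star_\<Phi>_skew[OF star_skew_part])
  then show ?thesis by (simp only: herm_part_plus_skew_part)
qed

section \<open>The Leibniz rule for the associative product\<close>

text \<open>
  The polarization identity \<open>double_star_mult\<close> writes \<open>2 a\<^sup>*b\<close> through the skew product and
  multiplication by \<open>i\<close>. As \<open>\<Phi>\<close> obeys the Leibniz rule for the former and commutes with the latter,
  the same identity, read backwards, reassembles the result.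
\<close>
lemma \<Phi>_star_mult: "\<Phi> (star a * b) = star (\<Phi> a) * b + star a * \<Phi> b"
proof (rule double_eq_imp_eq)
  have "\<Phi> (star a * b) + \<Phi> (star a * b)
      = \<Phi> (diamond star a b - scale \<i> (diamond star a (scale \<i> b)))"
    by (simp only: double_star_mult flip: \<Phi>_add)
  also have "\<dots> = (diamond star (\<Phi> a) b - scale \<i> (diamond star (\<Phi> a) (scale \<i> b)))
      + (diamond star a (\<Phi> b) - scale \<i> (diamond star a (scale \<i> (\<Phi> b))))"
    by (simp only: \<Phi>_diff \<Phi>_scale_i \<Phi>_diamond scale_right_distrib add_diff_add)
  also have "\<dots> = (star (\<Phi> a) * b + star (\<Phi> a) * b) + (star a * \<Phi> b + star a * \<Phi> b)"
    by (simp only: double_star_mult)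
  finally show "\<Phi> (star a * b) + \<Phi> (star a * b)
      = (star (\<Phi> a) * b + star a * \<Phi> b) + (star (\<Phi> a) * b + star a * \<Phi> b)"
    by (simp only: ac_simps)
qed

lemma \<Phi>_mult: "\<Phi> (a * b) = \<Phi> a * b + a * \<Phi> b"
  using \<Phi>_star_mult[of "star a" b] by (simp add: \<Phi>_star star_star)

end

theorem theorem2p1:
  fixes scale :: "complex \<Rightarrow> 'a::{ring,monoid_mult} \<Rightarrow> 'a"
    and star :: "'a \<Rightarrow> 'a"
    and \<Phi> :: "'a \<Rightarrow> 'a"
  assumes "prime_star_algebra scale star"
    and "\<forall>A B. \<Phi> (diamond star A B) = diamond star (\<Phi> A) B + diamond star A (\<Phi> B)"
    and "\<forall>\<alpha>\<in>{1, \<i>}. self_adjoint star (\<Phi> (scale \<alpha> (scale (1/2) 1)))"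
  shows "additive_star_derivation star \<Phi>"
proof -
  interpret prime_star_algebra scale star by fact
  interpret diamond_derivation scale star \<Phi>
    using assms(2,3) by unfold_locales (simp_all add: self_adjoint_def)
  show ?thesis
    by (simp add: additive_star_derivation_def additive_derivation_def \<Phi>_add \<Phi>_mult \<Phi>_star)
qed

end
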